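(* Let $n$ be a positive integer and $0\le k\le n$. Let $\mathrm{RInc}_k(2\times n)$ be the set of $2\times n$ arrays $T=(T_{i,j})_{1\le i\le 2,\,1\le j\le n}$ of positive integers such that each row is strictly increasing from left to right, each column is weakly increasing from top to bottom ($T_{1,j}\le T_{2,j}$), and the set of entries of $T$ is exactly $\{1,2,\ldots,2n-k\}$. Then \[ \sum_{T\in \mathrm{RInc}_k(2\times n)} q^{\mathrm{amaj}(T)}=\frac{q^{\,k(k-1)/2}}{[n-k+1]}\begin{bmatrix}2n-k\\ k\end{bmatrix}\begin{bmatrix}2n-2k\\ n-k\end{bmatrix}. \]
   Context: Rows are numbered from top (row 1) to bottom (row 2). For such a two-row array $T$, an integer $i$ is an ascent of $T$ if $i$ occurs in row 2 and $i+1$ occurs in row 1; $A(T)$ is the set of ascents and $\mathrm{amaj}(T)=\sum_{i\in A(T)} i$. Here $[m]=1+q+\cdots+q^{m-1}$, $[m]!=[1][2]\cdots[m]$, and $\begin{bmatrix}a\\ b\end{bmatrix}=\frac{[a]!}{[b]![a-b]!}$ is the $q$-binomial coefficient. *)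

theory Defs
  imports
    "HOL-Library.FuncSet"
    "HOL-Computational_Algebra.Computational_Algebra"
begin

text \<open>
  A two-row array with \<^term>\<open>n\<close> columns is a function on the index set
  \<^term>\<open>{1..2::nat} \<times> {1..n::nat}\<close>; extensionality makes distinct functions distinct arrays.
\<close>

definition RInc :: "nat \<Rightarrow> nat \<Rightarrow> (nat \<times> nat \<Rightarrow> nat) set" where
  "RInc k n =
    {T \<in> ({1..2} \<times> {1..n}) \<rightarrow>\<^sub>E {1..}.
       (\<forall>i\<in>{1..2}. strict_mono_on {1..n} (\<lambda>j. T (i, j))) \<and>
       (\<forall>j\<in>{1..n}. T (1, j) \<le> T (2, j)) \<and>
       T ` ({1..2} \<times> {1..n}) = {1..2 * n - k}}"

definition row :: "nat \<Rightarrow> (nat \<times> nat \<Rightarrow> nat) \<Rightarrow> nat \<Rightarrow> nat set" where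
  "row n T i = (\<lambda>j. T (i, j)) ` {1..n}"

definition ascents :: "nat \<Rightarrow> (nat \<times> nat \<Rightarrow> nat) \<Rightarrow> nat set" where
  "ascents n T = {i. i \<in> row n T 2 \<and> i + 1 \<in> row n T 1}"

definition amaj :: "nat \<Rightarrow> (nat \<times> nat \<Rightarrow> nat) \<Rightarrow> nat" where
  "amaj n T = (\<Sum>i\<in>ascents n T. i)"

definition q_int :: "'a::field \<Rightarrow> nat \<Rightarrow> 'a" where
  "q_int q m = (\<Sum>i<m. q ^ i)"

definition q_fact :: "'a::field \<Rightarrow> nat \<Rightarrow> 'a" where
  "q_fact q m = (\<Prod>i=1..m. q_int q i)"

text \<open>Only meaningful for \<^prop>\<open>b \<le> a\<close>, because of the truncated subtraction.\<close>

definition q_binomial :: "'a::field \<Rightarrow> nat \<Rightarrow> nat \<Rightarrow> 'a" where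
  "q_binomial q a b = q_fact q a / (q_fact q b * q_fact q (a - b))"

text \<open>The indeterminate, as an element of the field of rational functions (the fraction field of
  the integer polynomials), so that no \<open>q\<close>-integer with positive index vanishes.\<close>

definition indet :: "int poly fract" where
  "indet = to_fract [:0, 1:]"

end

theory Submission imports Defs begin

text \<open>
  An array is determined by its two rows \<open>A\<close> and \<open>B\<close> as sets; the column condition becomes the
  ballot condition that every initial segment contains at least as many elements of \<open>A\<close> as of
  \<open>B\<close>. Let \<open>a\<close>, \<open>b\<close>, \<open>k\<close> be the numbers of entries that occur only in \<open>A\<close>, only in \<open>B\<close>, and in
  both. Removing the largest entry gives linear recurrences for the generating function of such
  pairs, provided that one also tracks the pairs whose largest entry \<open>m = a + k + b\<close> is not in \<open>B\<close>,
  because whether a new entry of \<open>A\<close> creates an ascent depends exactly on this. With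
  \<open>M = q^(k choose 2) [m]! / ([a]! [k]! [b]!)\<close>, the recurrences are solved for \<open>b \<le> a\<close> by
  \<open>([a+1] - q [b]) / [a+1] * M\<close> for all pairs and \<open>q^(b+k) ([a] - [b]) / [m] * M\<close> for the
  restricted ones; the latter vanishes for \<open>a = b\<close>, which matches the ballot boundary. The theorem is
  the case \<open>a = b = n - k\<close>.
\<close>

section \<open>Pairs of sets with the ballot condition\<close>

text \<open>By inclusion-exclusion the cardinalities force an intersection of size \<open>k\<close>.
  Arrays only need \<open>a = b\<close>; unequal values arise when largest entries are
  removed.\<close>

definition ballot_pairs :: "nat \<Rightarrow> nat \<Rightarrow> nat \<Rightarrow> (nat set \<times> nat set) set" where
  "ballot_pairs a k b =
    {(A, B). A \<union> B = {1..a + k + b} \<and> card A = a + k \<and> card B = b + k \<and>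
      (\<forall>i. card (B \<inter> {1..i}) \<le> card (A \<inter> {1..i}))}"

definition pair_amaj :: "nat set \<times> nat set \<Rightarrow> nat" where
  "pair_amaj = (\<lambda>(A, B). \<Sum>{i \<in> B. Suc i \<in> A})"

lemma finite_ballot_pairs: "finite (ballot_pairs a k b)"
  by (rule finite_subset[of _ "Pow {1..a + k + b} \<times> Pow {1..a + k + b}"])
    (auto simp: ballot_pairs_def)

section \<open>Effect of appending a new largest entry\<close>

lemma card_insert_Suc_Int:
  assumes "A \<subseteq> {1..m}"
  shows "card (insert (Suc m) A \<inter> {1..i}) = card (A \<inter> {1..i}) + (if m < i then 1 else 0)"
proof (cases "m < i")
  case True
  then have "insert (Suc m) A \<inter> {1..i} = insert (Suc m) (A \<inter> {1..i})"
    by auto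
  moreover have "Suc m \<notin> A"
    using assms by auto
  ultimately show ?thesis
    using True by simp
next
  case False
  then have "insert (Suc m) A \<inter> {1..i} = A \<inter> {1..i}"
    by auto
  then show ?thesis
    using False by simp
qed

lemma card_insert_Suc:
  assumes "A \<subseteq> {1..m}"
  shows "card (insert (Suc m) A) = Suc (card A)"
  using assms by (subst card_insert_disjoint) (auto intro: finite_subset)

lemma Int_atLeastAtMost_eq:
  fixes A :: "nat set"
  assumes "A \<subseteq> {1..m}" "m \<le> i"
  shows "A \<inter> {1..i} = A"
  using assms by fastforce

text \<open>Only prefixes reaching \<open>Suc m\<close> change. For these the old condition follows
  from the prefix \<open>m\<close>, which already contains both sets.\<close>

lemma ballot_insert_left:
  assumes "A \<subseteq> {1..m}" "B \<subseteq> {1..m}"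
  shows "(\<forall>i. card (B \<inter> {1..i}) \<le> card (insert (Suc m) A \<inter> {1..i})) \<longleftrightarrow>
    (\<forall>i. card (B \<inter> {1..i}) \<le> card (A \<inter> {1..i}))"
proof
  assume l: "\<forall>i. card (B \<inter> {1..i}) \<le> card (insert (Suc m) A \<inter> {1..i})"
  show "\<forall>i. card (B \<inter> {1..i}) \<le> card (A \<inter> {1..i})"
  proof
    fix i
    show "card (B \<inter> {1..i}) \<le> card (A \<inter> {1..i})"
    proof (cases "m < i")
      case True
      then show ?thesis
        using l[rule_format, of m] assms
        by (simp add: card_insert_Suc_Int Int_atLeastAtMost_eq del: One_nat_def)
    next
      case False
      then show ?thesis
        using l[rule_format, of i] assms by (simp add: card_insert_Suc_Int del: One_nat_def)
    qed
  qed
qed (use assms in \<open>auto simp: card_insert_Suc_Int simp del: One_nat_def intro: trans_le_add1\<close>)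

text \<open>From \<open>Suc m\<close> on the second count grows by one, which the strict inequality
  of the cardinalities absorbs.\<close>

lemma ballot_insert_right:
  assumes "A \<subseteq> {1..m}" "B \<subseteq> {1..m}" "card B < card A"
  shows "(\<forall>i. card (insert (Suc m) B \<inter> {1..i}) \<le> card (A \<inter> {1..i})) \<longleftrightarrow>
    (\<forall>i. card (B \<inter> {1..i}) \<le> card (A \<inter> {1..i}))"
  using assms
  by (auto simp: card_insert_Suc_Int Int_atLeastAtMost_eq not_less simp del: One_nat_def split: if_splits)
     (metis Int_atLeastAtMost_eq Suc_leI less_imp_le not_less add_leD1)+

lemma ballot_insert_both:
  assumes "A \<subseteq> {1..m}" "B \<subseteq> {1..m}"
  shows "(\<forall>i. card (insert (Suc m) B \<inter> {1..i}) \<le> card (insert (Suc m) A \<inter> {1..i})) \<longleftrightarrow>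
    (\<forall>i. card (B \<inter> {1..i}) \<le> card (A \<inter> {1..i}))"
  using assms by (simp add: card_insert_Suc_Int del: One_nat_def)

text \<open>An ascent at \<open>Suc m\<close> would need \<open>Suc (Suc m)\<close> in
  \<open>A\<close>, which is too large.\<close>

lemma pair_amaj_insert_right:
  assumes "A \<subseteq> {1..m}"
  shows "pair_amaj (A, insert (Suc m) B) = pair_amaj (A, B)"
proof -
  have "{i \<in> insert (Suc m) B. Suc i \<in> A} = {i \<in> B. Suc i \<in> A}"
    using assms by auto
  then show ?thesis
    by (simp add: pair_amaj_def)
qed

text \<open>The only possible new ascent is \<open>m\<close>, followed by the new entry
  \<open>Suc m\<close> of the first set.\<close>

lemma pair_amaj_insert_left:
  assumes "A \<subseteq> {1..m}" "B \<subseteq> {1..m}"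
  shows "pair_amaj (insert (Suc m) A, B) = pair_amaj (A, B) + (if m \<in> B then m else 0)"
proof -
  have "{i \<in> B. Suc i \<in> insert (Suc m) A} = {i \<in> B. Suc i \<in> A} \<union> (if m \<in> B then {m} else {})"
    by auto
  moreover have "finite {i \<in> B. Suc i \<in> A}"
    using assms(2) by (auto intro: finite_subset)
  moreover have "Suc m \<notin> A"
    using assms by auto
  ultimately show ?thesis
    by (simp add: pair_amaj_def)
qed

lemma pair_amaj_insert_both:
  assumes "A \<subseteq> {1..m}" "B \<subseteq> {1..m}"
  shows "pair_amaj (insert (Suc m) A, insert (Suc m) B) = pair_amaj (A, B) + (if m \<in> B then m else 0)"
proof -
  have "pair_amaj (insert (Suc m) A, insert (Suc m) B) = pair_amaj (insert (Suc m) A, B)"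
    using assms by (auto simp: pair_amaj_def intro!: sum.cong)
  then show ?thesis
    using assms pair_amaj_insert_left by simp
qed

section \<open>Generating functions split by the position of the largest entry\<close>

definition ballot_gf :: "'a::field \<Rightarrow> nat \<Rightarrow> nat \<Rightarrow> nat \<Rightarrow> 'a" where
  "ballot_gf q a k b = (\<Sum>p\<in>ballot_pairs a k b. q ^ pair_amaj p)"

text \<open>The empty pair counts as one without largest entry in \<open>B\<close>, so that the recurrence for
  \<open>upper_gf\<close> also covers the first entry.\<close>

definition upper_gf :: "'a::field \<Rightarrow> nat \<Rightarrow> nat \<Rightarrow> nat \<Rightarrow> 'a" where
  "upper_gf q a k b = (\<Sum>p | p \<in> ballot_pairs a k b \<and> a + k + b \<notin> snd p. q ^ pair_amaj p)"

text \<open>The two sets cover \<open>{1..a + k + b}\<close>, so for a positive total this selects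
  the pairs whose largest entry is in the second set only.\<close>

definition lower_gf :: "'a::field \<Rightarrow> nat \<Rightarrow> nat \<Rightarrow> nat \<Rightarrow> 'a" where
  "lower_gf q a k b = (\<Sum>p | p \<in> ballot_pairs a k b \<and> a + k + b \<notin> fst p. q ^ pair_amaj p)"

definition both_gf :: "'a::field \<Rightarrow> nat \<Rightarrow> nat \<Rightarrow> nat \<Rightarrow> 'a" where
  "both_gf q a k b = (\<Sum>p | p \<in> ballot_pairs a k b \<and> a + k + b \<in> fst p \<and> a + k + b \<in> snd p.
     q ^ pair_amaj p)"

lemma sum_split_pred:
  assumes "finite S"
  shows "sum f S = (\<Sum>p | p \<in> S \<and> \<not> P p. f p) + (\<Sum>p | p \<in> S \<and> P p. f p)"
proof -
  have "S \<inter> {p. \<not> P p} = {p. p \<in> S \<and> \<not> P p}" "S - {p. \<not> P p} = {p. p \<in> S \<and> P p}"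
    by auto
  then show ?thesis
    using sum.Int_Diff[OF assms, of f "{p. \<not> P p}"] by simp
qed

lemma ballot_gf_split:
  assumes "a + k + b > 0"
  shows "ballot_gf q a k b = upper_gf q a k b + both_gf q a k b + lower_gf q a k b"
proof -
  let ?m = "a + k + b" and ?S = "ballot_pairs a k b" and ?f = "\<lambda>p. q ^ pair_amaj p"
  have top: "?m \<in> fst p \<or> ?m \<in> snd p" if "p \<in> ballot_pairs a k b" for p
    using that assms by (cases p) (auto simp: ballot_pairs_def)
  have fin: "finite {p. p \<in> ?S \<and> ?m \<in> snd p}"
    using finite_ballot_pairs by simp
  have "ballot_gf q a k b = upper_gf q a k b + (\<Sum>p | p \<in> ?S \<and> ?m \<in> snd p. ?f p)"
    unfolding ballot_gf_def upper_gf_def by (rule sum_split_pred[OF finite_ballot_pairs])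
  also have "(\<Sum>p | p \<in> ?S \<and> ?m \<in> snd p. ?f p) = lower_gf q a k b + both_gf q a k b"
    unfolding lower_gf_def both_gf_def
    by (subst sum_split_pred[OF fin, of _ "\<lambda>p. ?m \<in> fst p"])
       (intro arg_cong2[where f = "(+)"] sum.cong, use top in auto)
  finally show ?thesis
    by simp
qed

section \<open>Recurrences from removing the largest entry\<close>

lemma ballot_pairs_subset:
  assumes "(A, B) \<in> ballot_pairs a k b"
  shows "A \<subseteq> {1..a + k + b}" "B \<subseteq> {1..a + k + b}"
  using assms by (auto simp: ballot_pairs_def)

text \<open>The extra exponent is the ascent created when the next entry joins the first set; this
  sum is the right-hand side of two of the recurrences.\<close>

lemma sum_add_top:
  "(\<Sum>p\<in>ballot_pairs a k b. q ^ (pair_amaj p + (if a + k + b \<in> snd p then a + k + b else 0))) =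
    upper_gf q a k b + q ^ (a + k + b) * (ballot_gf q a k b - upper_gf q a k b)"
proof -
  let ?m = "a + k + b" and ?S = "ballot_pairs a k b"
  note U = sum_split_pred[OF finite_ballot_pairs[of a k b], of _ "\<lambda>p. ?m \<in> snd p"]
  have "ballot_gf q a k b - upper_gf q a k b = (\<Sum>p | p \<in> ?S \<and> ?m \<in> snd p. q ^ pair_amaj p)"
    unfolding ballot_gf_def upper_gf_def by (subst U) simp
  then show ?thesis
    by (subst U) (simp add: upper_gf_def power_add sum_distrib_left mult.commute)
qed


text \<open>The reindexing shared by the three recurrences: the flags \<open>x\<close> and
  \<open>y\<close> record which sets contain \<open>Suc m\<close>, so deleting it and putting it
  back are mutually inverse.\<close>

lemma sum_remove_top:
  fixes f :: "nat set \<times> nat set \<Rightarrow> 'c::comm_monoid_add"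
  defines "ins \<equiv> \<lambda>m x (A :: nat set). if x then insert (Suc m) A else A"
  assumes m: "m = a + k + b" and m': "a' + k' + b' = Suc m"
    and ins: "\<And>A B. A \<subseteq> {1..m} \<Longrightarrow> B \<subseteq> {1..m} \<Longrightarrow>
      (ins m x A, ins m y B) \<in> ballot_pairs a' k' b' \<longleftrightarrow> (A, B) \<in> ballot_pairs a k b"
  shows "(\<Sum>p | p \<in> ballot_pairs a' k' b' \<and> (Suc m \<in> fst p \<longleftrightarrow> x) \<and> (Suc m \<in> snd p \<longleftrightarrow> y). f p) =
    (\<Sum>(A, B)\<in>ballot_pairs a k b. f (ins m x A, ins m y B))"
proof -
  define top where "top = (\<lambda>(A, B). (A - {Suc m}, B - {Suc m}))"
  define add where "add = (\<lambda>(A, B). (ins m x A, ins m y B))"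
  have add_top: "add (top p) = p"
    if "Suc m \<in> fst p \<longleftrightarrow> x" "Suc m \<in> snd p \<longleftrightarrow> y" for p
    using that by (cases p) (auto simp: add_def top_def ins_def)
  have top_sub: "fst (top p) \<subseteq> {1..m} \<and> snd (top p) \<subseteq> {1..m}"
    if "p \<in> ballot_pairs a' k' b'" for p
  proof (cases p)
    case (Pair A B)
    then have "A \<subseteq> {1..Suc m}" "B \<subseteq> {1..Suc m}"
      using that m' ballot_pairs_subset[of A B a' k' b'] by auto
    then have "A - {Suc m} \<subseteq> {1..m}" "B - {Suc m} \<subseteq> {1..m}"
      by (auto simp: subset_iff le_Suc_eq)
    then show ?thesis
      by (simp add: Pair top_def)
  qed
  have sub: "fst p \<subseteq> {1..m} \<and> snd p \<subseteq> {1..m}" if "p \<in> ballot_pairs a k b" for p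
    using that m ballot_pairs_subset[of "fst p" "snd p" a k b] by simp
  have mem: "add p \<in> ballot_pairs a' k' b' \<longleftrightarrow> p \<in> ballot_pairs a k b"
    if "fst p \<subseteq> {1..m} \<and> snd p \<subseteq> {1..m}" for p
    using that ins[of "fst p" "snd p"] by (cases p) (simp add: add_def)
  have "(\<Sum>p | p \<in> ballot_pairs a' k' b' \<and> (Suc m \<in> fst p \<longleftrightarrow> x) \<and> (Suc m \<in> snd p \<longleftrightarrow> y). f p) =
    (\<Sum>p\<in>ballot_pairs a k b. f (add p))"
  proof (rule sum.reindex_bij_witness[where i = add and j = top], goal_cases)
    case (2 p)
    then show ?case
      using mem[of "top p"] top_sub[of p] add_top[of p] by simp
  next
    case (3 p)
    then have "Suc m \<notin> fst p" "Suc m \<notin> snd p"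
      using sub by fastforce+
    then show ?case
      by (cases p) (auto simp: top_def add_def ins_def)
  next
    case (4 p)
    then have "Suc m \<notin> fst p" "Suc m \<notin> snd p"
      using sub by fastforce+
    then show ?case
      using 4 mem[OF sub[OF 4]] by (cases p) (auto simp: add_def ins_def)
  qed (use add_top in auto)
  then show ?thesis
    by (simp add: add_def case_prod_beta)
qed

lemma Un_insert_Suc_eq:
  assumes "A \<subseteq> {1..m}" "B \<subseteq> {1..m}"
  shows "insert (Suc m) (A \<union> B) = {1..Suc m} \<longleftrightarrow> A \<union> B = {1..m}"
proof -
  have "Suc m \<notin> A \<union> B" "Suc m \<notin> {1..m}"
    using assms by auto
  moreover have "{1..Suc m} = insert (Suc m) {1..m}"
    by auto
  ultimately show ?thesis
    using insert_ident by metis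
qed

lemma upper_gf_Suc:
  "upper_gf q (Suc a) k b =
    upper_gf q a k b + q ^ (a + k + b) * (ballot_gf q a k b - upper_gf q a k b)"
proof -
  define m where "m = a + k + b"
  \<comment> \<open>An entry missing from the second set lies in the first, because the union is
    everything.\<close>
  have "upper_gf q (Suc a) k b = (\<Sum>p | p \<in> ballot_pairs (Suc a) k b \<and>
      (Suc m \<in> fst p \<longleftrightarrow> True) \<and> (Suc m \<in> snd p \<longleftrightarrow> False). q ^ pair_amaj p)"
    unfolding upper_gf_def by (rule sum.cong) (auto simp: m_def ballot_pairs_def)
  also have "\<dots> = (\<Sum>(A, B)\<in>ballot_pairs a k b. q ^ pair_amaj (insert (Suc m) A, B))"
    by (subst sum_remove_top[OF m_def])
       (auto simp: ballot_pairs_def m_def[symmetric] Un_insert_Suc_eq card_insert_Suc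
          ballot_insert_left simp del: One_nat_def)
  also have "\<dots> = (\<Sum>p\<in>ballot_pairs a k b. q ^ (pair_amaj p + (if m \<in> snd p then m else 0)))"
    by (intro sum.cong refl, clarify, subst pair_amaj_insert_left)
      (use ballot_pairs_subset[of _ _ a k b] in \<open>auto simp: m_def\<close>)
  finally show ?thesis
    unfolding m_def sum_add_top .
qed

text \<open>The right-hand side agrees with that of \<open>upper_gf_Suc\<close>: the copy of the new
  entry in the second set creates no ascent.\<close>

lemma both_gf_Suc:
  "both_gf q a (Suc k) b =
    upper_gf q a k b + q ^ (a + k + b) * (ballot_gf q a k b - upper_gf q a k b)"
proof -
  define m where "m = a + k + b"
  have "both_gf q a (Suc k) b = (\<Sum>p | p \<in> ballot_pairs a (Suc k) b \<and>
      (Suc m \<in> fst p \<longleftrightarrow> True) \<and> (Suc m \<in> snd p \<longleftrightarrow> True). q ^ pair_amaj p)"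
    unfolding both_gf_def by (rule sum.cong) (auto simp: m_def)
  also have "\<dots> = (\<Sum>(A, B)\<in>ballot_pairs a k b. q ^ pair_amaj (insert (Suc m) A, insert (Suc m) B))"
    by (subst sum_remove_top[OF m_def])
       (auto simp: ballot_pairs_def m_def[symmetric] Un_insert_Suc_eq card_insert_Suc
          ballot_insert_both simp del: One_nat_def)
  also have "\<dots> = (\<Sum>p\<in>ballot_pairs a k b. q ^ (pair_amaj p + (if m \<in> snd p then m else 0)))"
    by (intro sum.cong refl, clarify, subst pair_amaj_insert_both)
      (use ballot_pairs_subset[of _ _ a k b] in \<open>auto simp: m_def\<close>)
  finally show ?thesis
    unfolding m_def sum_add_top .
qed

text \<open>No ascent is created, so no power of \<open>q\<close> appears; \<open>b < a\<close>
  leaves room for the new entry under the ballot condition.\<close>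

lemma lower_gf_Suc:
  assumes "b < a"
  shows "lower_gf q a k (Suc b) = ballot_gf q a k b"
proof -
  define m where "m = a + k + b"
  have "lower_gf q a k (Suc b) = (\<Sum>p | p \<in> ballot_pairs a k (Suc b) \<and>
      (Suc m \<in> fst p \<longleftrightarrow> False) \<and> (Suc m \<in> snd p \<longleftrightarrow> True). q ^ pair_amaj p)"
    unfolding lower_gf_def by (rule sum.cong) (auto simp: m_def ballot_pairs_def)
  also have "\<dots> = (\<Sum>(A, B)\<in>ballot_pairs a k b. q ^ pair_amaj (A, insert (Suc m) B))"
    by (subst sum_remove_top[OF m_def])
       (use assms in \<open>simp_all add: ballot_pairs_def m_def[symmetric] Un_insert_Suc_eq card_insert_Suc
          ballot_insert_right del: One_nat_def cong: conj_cong\<close>)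
  also have "\<dots> = ballot_gf q a k b"
    unfolding ballot_gf_def
    by (intro sum.cong refl, clarify, subst pair_amaj_insert_right)
      (use ballot_pairs_subset[of _ _ a k b] in \<open>auto simp: m_def\<close>)
  finally show ?thesis .
qed

section \<open>Boundary values\<close>

lemma ballot_pairs_empty:
  assumes "a < b"
  shows "ballot_pairs a k b = {}"
proof -
  have False if "(A, B) \<in> ballot_pairs a k b" for A B
  proof -
    have "A \<inter> {1..a + k + b} = A" "B \<inter> {1..a + k + b} = B"
      using ballot_pairs_subset[OF that] by auto
    moreover have "card (B \<inter> {1..a + k + b}) \<le> card (A \<inter> {1..a + k + b})"
      using that by (simp add: ballot_pairs_def)
    ultimately show False
      using that assms by (simp add: ballot_pairs_def)
  qed
  then show ?thesis
    by auto
qed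

lemma card_Int_ballot_pairs:
  assumes "(A, B) \<in> ballot_pairs a k b"
  shows "card (A \<inter> B) = k"
proof -
  have "finite A" "finite B"
    using ballot_pairs_subset[OF assms] finite_subset by blast+
  then show ?thesis
    using assms card_Un_Int[of A B] by (simp add: ballot_pairs_def)
qed

lemma both_gf_0: "both_gf q a 0 b = 0"
proof -
  have "{p. p \<in> ballot_pairs a 0 b \<and> a + 0 + b \<in> fst p \<and> a + 0 + b \<in> snd p} = {}"
    using card_Int_ballot_pairs[of _ _ a 0 b] ballot_pairs_subset[of _ _ a 0 b]
    by (force simp: card_eq_0_iff dest: finite_subset)
  then show ?thesis
    unfolding both_gf_def by (simp only: sum.empty)
qed

text \<open>The first set has as many elements as \<open>{1..a + k}\<close> and hence is all of it.
  Positivity excludes the empty pair, which would contribute 1.\<close>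

lemma lower_gf_0:
  assumes "a + k > 0"
  shows "lower_gf q a k 0 = 0"
proof -
  have "A = {1..a + k}" if "(A, B) \<in> ballot_pairs a k 0" for A B
    using that by (intro card_subset_eq) (auto simp: ballot_pairs_def)
  then have "{p. p \<in> ballot_pairs a k 0 \<and> a + k + 0 \<notin> fst p} = {}"
    using assms by force
  then show ?thesis
    unfolding lower_gf_def by (simp only: sum.empty)
qed

text \<open>Deleting a largest entry that is only in the first set would leave fewer entries there
  than in the second.\<close>

lemma upper_gf_diag:
  assumes "a + k > 0"
  shows "upper_gf q a k a = 0"
proof (cases a)
  case 0
  have "B = {1..k}" if "(A, B) \<in> ballot_pairs 0 k 0" for A B
    using that by (intro card_subset_eq) (auto simp: ballot_pairs_def)
  then have "{p. p \<in> ballot_pairs 0 k 0 \<and> 0 + k + 0 \<notin> snd p} = {}"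
    using assms 0 by force
  then show ?thesis
    unfolding upper_gf_def 0 by (simp only: sum.empty)
next
  case (Suc c)
  then show ?thesis
    by (simp add: upper_gf_Suc) (simp add: ballot_gf_def upper_gf_def ballot_pairs_empty)
qed

lemma ballot_gf_0: "ballot_gf q 0 0 0 = 1"
proof -
  have "ballot_pairs 0 0 0 = {({}, {})}"
    by (auto simp: ballot_pairs_def)
  then show ?thesis
    by (simp add: ballot_gf_def pair_amaj_def)
qed

section \<open>Closed form of the generating functions\<close>

lemma q_int_0 [simp]: "q_int q 0 = 0"
  by (simp add: q_int_def)

lemma q_int_Suc: "q_int q (Suc j) = q_int q j + q ^ j"
  by (simp add: q_int_def)

lemma q_int_add: "q_int q (i + j) = q_int q i + q ^ i * q_int q j"
  by (induction j) (simp_all add: q_int_Suc algebra_simps power_add)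

lemma q_int_geometric: "(1 - q) * q_int q j = 1 - q ^ j"
  by (induction j) (simp_all add: q_int_Suc distrib_left, simp add: algebra_simps)

lemma q_fact_0 [simp]: "q_fact q 0 = 1"
  by (simp add: q_fact_def)

lemma q_fact_Suc: "q_fact q (Suc j) = q_int q (Suc j) * q_fact q j"
  by (simp add: q_fact_def)

lemma q_fact_nonzero:
  assumes "\<And>j. q_int q (Suc j) \<noteq> 0"
  shows "q_fact q j \<noteq> 0"
  by (induction j) (simp_all add: q_fact_Suc assms)

lemma to_fract_power: "to_fract (x ^ j) = to_fract x ^ j"
  by (induction j) simp_all

lemma indet_q_int_nonzero: "q_int indet (Suc j) \<noteq> 0"
proof -
  have "q_int indet (Suc j) = to_fract (\<Sum>i<Suc j. monom 1 i)"
    by (simp add: q_int_def indet_def monom_altdef to_fract_power to_fract_sum del: sum.lessThan_Suc)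
  \<comment> \<open>Evaluation at 1 witnesses that the polynomial is nonzero.\<close>
  moreover have "poly (\<Sum>i<Suc j. monom 1 i) 1 = (int (Suc j))"
    by (simp add: poly_sum poly_monom)
  ultimately show ?thesis
    by (metis of_nat_0_eq_iff nat.distinct(1) poly_0 to_fract_eq_0_iff)
qed

text \<open>The q-multinomial coefficient of \<open>a\<close>, \<open>k\<close>, \<open>b\<close>,
  times \<open>q ^ (k choose 2)\<close>.\<close>

definition super_multinomial :: "'a::field \<Rightarrow> nat \<Rightarrow> nat \<Rightarrow> nat \<Rightarrow> 'a" where
  "super_multinomial q a k b =
    q ^ (k choose 2) * q_fact q (a + k + b) / (q_fact q a * q_fact q k * q_fact q b)"

lemma super_multinomial_0: "super_multinomial q 0 0 0 = 1"
  by (simp add: super_multinomial_def numeral_2_eq_2)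

section \<open>Solving the recurrences when the q-integers of positive index are nonzero\<close>

context
  fixes q :: "'a::field"
  assumes nz: "\<And>j. q_int q (Suc j) \<noteq> 0"
begin

lemma super_multinomial_Suc1:
  "q_int q (Suc a) * super_multinomial q (Suc a) k b =
    q_int q (Suc (a + k + b)) * super_multinomial q a k b"
  using nz[of a] q_fact_nonzero[OF nz] by (simp add: super_multinomial_def q_fact_Suc field_simps)

lemma super_multinomial_Suc2:
  "q_int q (Suc k) * super_multinomial q a (Suc k) b =
    q ^ k * q_int q (Suc (a + k + b)) * super_multinomial q a k b"
  using nz[of k] q_fact_nonzero[OF nz]
  by (simp add: super_multinomial_def q_fact_Suc field_simps numeral_2_eq_2 power_add)

lemma super_multinomial_Suc3:
  "q_int q (Suc b) * super_multinomial q a k (Suc b) =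
    q_int q (Suc (a + k + b)) * super_multinomial q a k b"
  using nz[of b] q_fact_nonzero[OF nz] by (simp add: super_multinomial_def q_fact_Suc field_simps)

text \<open>Converts the two closed forms into one for the common right-hand side of
  \<open>upper_gf_Suc\<close> and \<open>both_gf_Suc\<close>. Being free of division, it includes
  \<open>m = 0\<close>.\<close>

lemma append_step_closed_form:
  fixes a k b :: nat
  defines "M \<equiv> super_multinomial q a k b" and "m \<equiv> a + k + b"
  assumes G: "q_int q (Suc a) * g = M * (q_int q (Suc a) - q * q_int q b)"
    and U: "q_int q m * u = q ^ (b + k) * (q_int q a - q_int q b) * M"
  shows "q_int q (Suc a) * (u + q ^ m * (g - u)) =
    q ^ (b + k) * (q_int q (Suc a) - q_int q b) * M"
proof -
  define x y z where "x = q ^ a" and "y = q ^ b" and "z = q ^ k"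
  define \<alpha> \<alpha>' \<beta> \<mu> where "\<alpha> = q_int q a" and "\<alpha>' = q_int q (Suc a)" and "\<beta> = q_int q b" and "\<mu> = q_int q m"
  have geo: "(1 - q) * \<alpha> = 1 - x" "(1 - q) * \<alpha>' = 1 - q * x" "(1 - q) * \<beta> = 1 - y"
      "(1 - q) * \<mu> = 1 - x * y * z"
    unfolding \<alpha>_def \<alpha>'_def \<beta>_def \<mu>_def q_int_geometric
    by (simp_all add: x_def y_def z_def m_def power_add mult_ac)
  have pows: "q ^ m = x * y * z" "q ^ (b + k) = y * z"
    by (simp_all add: x_def y_def z_def m_def power_add mult_ac)
  \<comment> \<open>Regrouped so that \<open>g\<close> and \<open>u\<close> occur only in
    \<open>\<alpha>' * g\<close> and \<open>(1 - q) * \<mu> * u\<close>, which the hypotheses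
    evaluate.\<close>
  have "\<alpha>' * (u + x * y * z * (g - u)) = x * y * z * (\<alpha>' * g) + \<alpha>' * (1 - x * y * z) * u"
    by (simp add: algebra_simps)
  also have "\<dots> = x * y * z * (\<alpha>' * g) + \<alpha>' * (1 - q) * (\<mu> * u)"
    using geo(4) by (simp flip: geo(4))
  also have "\<dots> = x * y * z * (M * (\<alpha>' - q * \<beta>)) + \<alpha>' * (1 - q) * (y * z * (\<alpha> - \<beta>) * M)"
    using G U unfolding pows \<alpha>_def \<alpha>'_def \<beta>_def \<mu>_def by simp
  \<comment> \<open>After \<open>(1 - q) * (\<alpha> - \<beta>) = y - x\<close>, what remains is
    \<open>\<alpha>' * (1 - y) = \<beta> * (1 - q * x)\<close>; both sides are
    \<open>(1 - q) * \<alpha>' * \<beta>\<close>.\<close>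
  also have "\<dots> = y * z * (\<alpha>' - \<beta>) * M"
    using geo by algebra
  finally show ?thesis
    unfolding pows \<alpha>_def \<alpha>'_def \<beta>_def .
qed

text \<open>The recurrences couple both functions, so both formulas are proved together, by
  induction on the largest entry \<open>a + k + b\<close>.\<close>

lemma ballot_gf_closed_form:
  assumes "b \<le> a"
  shows "q_int q (Suc a) * ballot_gf q a k b =
      super_multinomial q a k b * (q_int q (Suc a) - q * q_int q b)"
    and "q_int q (a + k + b) * upper_gf q a k b =
      q ^ (b + k) * (q_int q a - q_int q b) * super_multinomial q a k b"
proof -
  have "q_int q (Suc a) * ballot_gf q a k b =
      super_multinomial q a k b * (q_int q (Suc a) - q * q_int q b) \<and>
    q_int q (a + k + b) * upper_gf q a k b =
      q ^ (b + k) * (q_int q a - q_int q b) * super_multinomial q a k b"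
    using assms
  proof (induction "a + k + b" arbitrary: a k b)
    case 0
    then show ?case
      by (simp add: ballot_gf_0 super_multinomial_0)
  next
    case (Suc m)
    define H where
      "H a k b = upper_gf q a k b + q ^ (a + k + b) * (ballot_gf q a k b - upper_gf q a k b)"
      for a k b
    define M where "M = super_multinomial q a k b"
    define \<mu> where "\<mu> = q_int q (a + k + b)"
    have H: "q_int q (Suc c) * H c j d =
        q ^ (d + j) * (q_int q (Suc c) - q_int q d) * super_multinomial q c j d"
      if "m = c + j + d" "d \<le> c" for c j d
      unfolding H_def using Suc.hyps(1)[OF that] by (intro append_step_closed_form) auto
    have U: "\<mu> * upper_gf q a k b = q ^ (b + k) * (q_int q a - q_int q b) * M"
    \<comment> \<open>On the diagonal, lowering \<open>a\<close> would leave the range of the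
      induction hypothesis, but there both sides vanish.\<close>
    proof (cases "a = b")
      case True
      have "a + k > 0"
        using Suc.hyps(2) True by linarith
      then show ?thesis
        using upper_gf_diag[of a k q] True by simp
    next
      case False
      then obtain c where c: "a = Suc c" "b \<le> c"
        using Suc.prems by (cases a) auto
      have "q_int q a * (\<mu> * upper_gf q a k b) = \<mu> * (q_int q (Suc c) * H c k b)"
        by (simp add: c upper_gf_Suc H_def mult_ac)
      also have "\<dots> = \<mu> * (q ^ (b + k) * (q_int q a - q_int q b) * super_multinomial q c k b)"
        using Suc.hyps(2) c by (subst H) auto
      also have "\<dots> = q ^ (b + k) * (q_int q a - q_int q b) * (\<mu> * super_multinomial q c k b)"
        by (simp add: mult_ac)
      also have "\<mu> * super_multinomial q c k b = q_int q a * M"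
        using super_multinomial_Suc1[of c k b] by (simp add: c M_def \<mu>_def)
      finally have "q_int q a * (\<mu> * upper_gf q a k b) =
          q_int q a * (q ^ (b + k) * (q_int q a - q_int q b) * M)"
        by (simp add: mult_ac)
      then show ?thesis
        using nz[of c] by (simp add: c)
    qed
    have B: "\<mu> * (q_int q (Suc a) * both_gf q a k b) =
        q ^ b * q_int q k * (q_int q (Suc a) - q_int q b) * M"
    proof (cases k)
      case 0
      then show ?thesis
        by (simp add: both_gf_0)
    next
      case (Suc j)
      have "\<mu> * (q_int q (Suc a) * both_gf q a k b) = \<mu> * (q_int q (Suc a) * H a j b)"
        by (simp add: Suc both_gf_Suc H_def)
      also have "\<dots> = \<mu> * (q ^ (b + j) * (q_int q (Suc a) - q_int q b) * super_multinomial q a j b)"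
        using Suc.hyps(2) Suc.prems Suc by (subst H) auto
      also have "\<dots> = q ^ b * (q_int q (Suc a) - q_int q b) * (q ^ j * \<mu> * super_multinomial q a j b)"
        by (simp add: power_add mult_ac)
      also have "q ^ j * \<mu> * super_multinomial q a j b = q_int q k * M"
        using super_multinomial_Suc2[of j a b] by (simp add: Suc M_def \<mu>_def)
      finally show ?thesis
        by (simp add: mult_ac)
    qed
    \<comment> \<open>Stated through \<open>q_int q b\<close> instead of the index below it, so that
      for \<open>b = 0\<close> both sides are 0.\<close>
    have D: "\<mu> * (q_int q (Suc a) * lower_gf q a k b) =
        q_int q b * (q_int q (Suc a) - q_int q b + 1) * M"
    proof (cases b)
      case 0
      have "a + k > 0"
        using Suc.hyps(2) 0 by linarith
      then show ?thesis
        using lower_gf_0[of a k q] 0 by simp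
    next
      case (Suc d)
      have "\<mu> * (q_int q (Suc a) * lower_gf q a k b) = \<mu> * (q_int q (Suc a) * ballot_gf q a k d)"
        using Suc.prems Suc by (simp add: lower_gf_Suc)
      also have "\<dots> = \<mu> * (super_multinomial q a k d * (q_int q (Suc a) - q * q_int q d))"
        using Suc.hyps(1)[of a k d] Suc.hyps(2) Suc.prems Suc by simp
      also have "\<dots> = (q_int q (Suc a) - q * q_int q d) * (\<mu> * super_multinomial q a k d)"
        by (simp add: mult_ac)
      also have "\<mu> * super_multinomial q a k d = q_int q b * M"
        using super_multinomial_Suc3[of d a k] by (simp add: Suc M_def \<mu>_def)
      also have "q * q_int q d = q_int q b - 1"
        using q_int_add[of q 1 d] by (simp add: Suc q_int_Suc)
      finally show ?thesis
        by (simp add: mult_ac)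
    qed
    have \<mu>: "\<mu> \<noteq> 0"
      using nz[of m] Suc.hyps(2) by (simp add: \<mu>_def)
    define x y z where "x = q ^ a" and "y = q ^ b" and "z = q ^ k"
    define \<alpha> \<alpha>' \<beta> \<kappa> where "\<alpha> = q_int q a" and "\<alpha>' = q_int q (Suc a)" and "\<beta> = q_int q b" and "\<kappa> = q_int q k"
    have rel: "(1 - q) * \<beta> = 1 - y" "(1 - q) * \<kappa> = 1 - z" "\<alpha>' = 1 + q * \<alpha>"
      using q_int_add[of q 1 a]
      by (simp_all add: q_int_geometric y_def z_def \<alpha>_def \<alpha>'_def \<beta>_def \<kappa>_def q_int_Suc)
    \<comment> \<open>Splitting the total in the order \<open>b\<close>, \<open>k\<close>,
      \<open>a\<close> matches its parts with the lower, both and upper contributions.\<close>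
    have \<mu>_eq: "\<mu> = \<beta> + y * \<kappa> + y * z * \<alpha>"
      using q_int_add[of q "b + k" a] q_int_add[of q b k]
      by (simp add: \<mu>_def \<alpha>_def \<beta>_def \<kappa>_def y_def z_def power_add add_ac)
    have "\<mu> * (\<alpha>' * ballot_gf q a k b) = \<alpha>' * (\<mu> * upper_gf q a k b) +
        \<mu> * (\<alpha>' * both_gf q a k b) + \<mu> * (\<alpha>' * lower_gf q a k b)"
      using ballot_gf_split[of a k b q] Suc.hyps(2)[symmetric] by (simp add: distrib_left mult_ac)
    also have "\<dots> = \<alpha>' * (y * z * (\<alpha> - \<beta>) * M) + y * \<kappa> * (\<alpha>' - \<beta>) * M + \<beta> * (\<alpha>' - \<beta> + 1) * M"
      using U B D by (simp add: \<alpha>_def \<alpha>'_def \<beta>_def \<kappa>_def y_def z_def power_add)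
    \<comment> \<open>Up to the factor \<open>M\<close>, the lower, both and upper terms differ from
      the matching parts of the right side by \<open>y * \<beta>\<close>,
      \<open>- y * \<beta> * (1 - z)\<close> and \<open>- y * z * \<beta>\<close>, which add up to
      0.\<close>
    also have "\<dots> = \<mu> * (M * (\<alpha>' - q * \<beta>))"
      using rel \<mu>_eq by algebra
    finally have "\<alpha>' * ballot_gf q a k b = M * (\<alpha>' - q * \<beta>)"
      using \<mu> by simp
    then show ?case
      using U by (simp add: M_def \<mu>_def \<alpha>'_def \<beta>_def)
  qed
  then show "q_int q (Suc a) * ballot_gf q a k b =
      super_multinomial q a k b * (q_int q (Suc a) - q * q_int q b)"
    and "q_int q (a + k + b) * upper_gf q a k b =
      q ^ (b + k) * (q_int q a - q_int q b) * super_multinomial q a k b"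
    by auto
qed

end

section \<open>Arrays as pairs of rows\<close>

lemma card_image_Int_atMost:
  fixes f :: "nat \<Rightarrow> nat"
  assumes "strict_mono_on {1..n} f" "f ` {1..n} \<subseteq> {1..}"
  shows "card (f ` {1..n} \<inter> {1..i}) = card {j \<in> {1..n}. f j \<le> i}"
proof -
  have "f ` {1..n} \<inter> {1..i} = f ` {j \<in> {1..n}. f j \<le> i}"
    using assms(2) by (auto simp: image_subset_iff)
  moreover have "inj_on f {j \<in> {1..n}. f j \<le> i}"
    using strict_mono_on_imp_inj_on[OF assms(1)] by (rule inj_on_subset) auto
  ultimately show ?thesis
    by (simp add: card_image)
qed

lemma pointwise_le_iff_card_le:
  fixes f g :: "nat \<Rightarrow> nat"
  assumes f: "strict_mono_on {1..n} f" "f ` {1..n} \<subseteq> {1..}"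
    and g: "strict_mono_on {1..n} g" "g ` {1..n} \<subseteq> {1..}"
  shows "(\<forall>j\<in>{1..n}. f j \<le> g j) \<longleftrightarrow>
    (\<forall>i. card (g ` {1..n} \<inter> {1..i}) \<le> card (f ` {1..n} \<inter> {1..i}))"
  unfolding card_image_Int_atMost[OF f] card_image_Int_atMost[OF g]
proof safe
  fix i
  assume "\<forall>j\<in>{1..n}. f j \<le> g j"
  then show "card {j \<in> {1..n}. g j \<le> i} \<le> card {j \<in> {1..n}. f j \<le> i}"
    by (intro card_mono) (auto intro: order_trans)
next
  fix j
  assume le: "\<forall>i. card {j \<in> {1..n}. g j \<le> i} \<le> card {j \<in> {1..n}. f j \<le> i}" and j: "j \<in> {1..n}"
  show "f j \<le> g j"
  proof (rule ccontr)
    assume less: "\<not> f j \<le> g j"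
    \<comment> \<open>The prefix ending at \<open>g j\<close> violates the count: it contains at
      least \<open>j\<close> values of \<open>g\<close> but fewer than \<open>j\<close> of
      \<open>f\<close>.\<close>
    have "{1..j} \<subseteq> {j' \<in> {1..n}. g j' \<le> g j}"
      using j strict_mono_on_leD[OF g(1)] by auto
    then have "j \<le> card {j' \<in> {1..n}. g j' \<le> g j}"
      using card_mono[of "{j' \<in> {1..n}. g j' \<le> g j}" "{1..j}"] by simp
    also have "\<dots> \<le> card {j' \<in> {1..n}. f j' \<le> g j}"
      using le by blast
    also have "{j' \<in> {1..n}. f j' \<le> g j} \<subseteq> {1..<j}"
    proof safe
      fix j' assume j': "j' \<in> {1..n}" "f j' \<le> g j"
      have "j' < j"
      proof (rule ccontr)
        assume "\<not> j' < j"
        then have "f j \<le> f j'"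
          using j j' strict_mono_on_leD[OF f(1)] by auto
        with j' less show False by simp
      qed
      with j' show "j' \<in> {1..<j}" by simp
    qed
    then have "card {j' \<in> {1..n}. f j' \<le> g j} \<le> card {1..<j}"
      by (intro card_mono) auto
    finally show False
      using j by auto
  qed
qed

text \<open>Equal images have equal prefix counts, so the comparison applies in both
  directions.\<close>

lemma strict_mono_on_eq_if_image_eq:
  fixes f g :: "nat \<Rightarrow> nat"
  assumes "strict_mono_on {1..n} f" "strict_mono_on {1..n} g" "f ` {1..n} \<subseteq> {1..}"
    and "f ` {1..n} = g ` {1..n}" "j \<in> {1..n}"
  shows "f j = g j"
proof (rule antisym)
  show "f j \<le> g j"
    using pointwise_le_iff_card_le[of n f g] assms by auto
  show "g j \<le> f j"
    using pointwise_le_iff_card_le[of n g f] assms by auto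
qed

lemma ex_strict_mono_on_image:
  fixes A :: "nat set"
  assumes "finite A"
  obtains f where "strict_mono_on {1..card A} f" "f ` {1..card A} = A"
proof -
  obtain r where r: "strict_mono_on {..<card A} r" "\<And>j. j < card A \<Longrightarrow> r j \<in> A"
    using finite_enumerate[OF assms] by blast
  \<comment> \<open>The library enumeration starts at 0, columns at 1.\<close>
  define f where "f j = r (j - 1)" for j
  have mono: "strict_mono_on {1..card A} f"
    by (intro strict_mono_onI) (auto simp: f_def intro!: strict_mono_onD[OF r(1)])
  have "card (f ` {1..card A}) = card A"
    using strict_mono_on_imp_inj_on[OF mono] by (simp add: card_image)
  then have "f ` {1..card A} = A"
    using assms r(2) by (intro card_subset_eq) (auto simp: f_def)
  with mono show thesis
    by (rule that)
qed

text \<open>A strictly increasing row is determined by its set of entries, and every set of the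
  right size can be enumerated as a row.\<close>

lemma bij_betw_rows:
  assumes "k \<le> n"
  shows "bij_betw (\<lambda>T. (row n T 1, row n T 2)) (RInc k n) (ballot_pairs (n - k) k (n - k))"
proof -
  have two: "{1..2::nat} = {1, 2}"
    by auto
  have len: "n - k + k + (n - k) = 2 * n - k"
    using assms by simp
  have image: "T ` ({1..2} \<times> {1..n}) = row n T 1 \<union> row n T 2" for T :: "nat \<times> nat \<Rightarrow> nat"
    unfolding two row_def by auto
  have RInc_iff: "T \<in> RInc k n \<longleftrightarrow> T \<in> extensional ({1..2} \<times> {1..n}) \<and>
      strict_mono_on {1..n} (\<lambda>j. T (1, j)) \<and> strict_mono_on {1..n} (\<lambda>j. T (2, j)) \<and>
      (row n T 1, row n T 2) \<in> ballot_pairs (n - k) k (n - k)" (is "_ \<longleftrightarrow> ?R") for T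
  proof -
    have "T \<in> RInc k n \<longleftrightarrow> T \<in> extensional ({1..2} \<times> {1..n}) \<and>
      strict_mono_on {1..n} (\<lambda>j. T (1, j)) \<and> strict_mono_on {1..n} (\<lambda>j. T (2, j)) \<and>
      (\<forall>j\<in>{1..n}. T (1, j) \<le> T (2, j)) \<and> row n T 1 \<union> row n T 2 = {1..2 * n - k}"
      by (auto simp: RInc_def image[symmetric] PiE_def Pi_def two simp del: One_nat_def)
    also have "\<dots> \<longleftrightarrow> ?R"
    proof (intro conj_cong refl)
      assume mono: "strict_mono_on {1..n} (\<lambda>j. T (1, j))" "strict_mono_on {1..n} (\<lambda>j. T (2, j))"
      have "card (row n T 1) = n" "card (row n T 2) = n"
        using mono[THEN strict_mono_on_imp_inj_on] by (simp_all add: row_def card_image)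
      \<comment> \<open>The assumed union supplies the positivity of the entries that the comparison
        requires.\<close>
      moreover have "(\<forall>j\<in>{1..n}. T (1, j) \<le> T (2, j)) \<longleftrightarrow>
          (\<forall>i. card (row n T 2 \<inter> {1..i}) \<le> card (row n T 1 \<inter> {1..i}))"
        if "row n T 1 \<union> row n T 2 = {1..2 * n - k}"
        unfolding row_def using that
        by (intro pointwise_le_iff_card_le mono) (auto simp: row_def)
      ultimately show "((\<forall>j\<in>{1..n}. T (1, j) \<le> T (2, j)) \<and> row n T 1 \<union> row n T 2 = {1..2 * n - k}) \<longleftrightarrow>
          (row n T 1, row n T 2) \<in> ballot_pairs (n - k) k (n - k)"
        using assms unfolding ballot_pairs_def len by auto
    qed
    finally show ?thesis .
  qed
  show ?thesis
  proof (rule bij_betwI')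
    fix T T'
    assume T: "T \<in> RInc k n" and T': "T' \<in> RInc k n"
    show "((row n T 1, row n T 2) = (row n T' 1, row n T' 2)) = (T = T')"
    proof
      assume rows: "(row n T 1, row n T 2) = (row n T' 1, row n T' 2)"
      show "T = T'"
      proof (rule extensionalityI)
        show "T \<in> extensional ({1..2} \<times> {1..n})" "T' \<in> extensional ({1..2} \<times> {1..n})"
          using T T' RInc_iff by blast+
        fix p assume "p \<in> {1..2::nat} \<times> {1..n}"
        then obtain i j where p: "p = (i, j)" "i = 1 \<or> i = 2" "j \<in> {1..n}"
          unfolding two by auto
        have sub: "row n T i \<subseteq> {1..}"
          using T p(2) ballot_pairs_subset[of "row n T 1" "row n T 2"] unfolding RInc_iff by fastforce
        have "T (i, j) = T' (i, j)"
          using T T' rows p sub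
          by (intro strict_mono_on_eq_if_image_eq[of n "\<lambda>j. T (i, j)" "\<lambda>j. T' (i, j)"])
            (auto simp: RInc_iff row_def)
        then show "T p = T' p"
          by (simp add: p)
      qed
    qed simp
  next
    fix T assume "T \<in> RInc k n"
    then show "(row n T 1, row n T 2) \<in> ballot_pairs (n - k) k (n - k)"
      by (simp add: RInc_iff)
  next
    fix p assume p: "p \<in> ballot_pairs (n - k) k (n - k)"
    obtain A B where AB: "p = (A, B)"
      by (cases p)
    have fin: "finite A" "finite B" and card: "card A = n" "card B = n"
      using p assms ballot_pairs_subset[of A B "n - k" k "n - k"] unfolding AB
      by (auto simp: ballot_pairs_def intro: finite_subset)
    obtain f g where f: "strict_mono_on {1..n} f" "f ` {1..n} = A"
      and g: "strict_mono_on {1..n} g" "g ` {1..n} = B"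
      using ex_strict_mono_on_image[OF fin(1)] ex_strict_mono_on_image[OF fin(2)] card by metis
    define T where "T = restrict (\<lambda>(i, j). if i = 1 then f j else g j) ({1..2::nat} \<times> {1..n})"
    have rows: "row n T 1 = A" "row n T 2 = B"
      by (auto simp: row_def T_def f(2)[symmetric] g(2)[symmetric])
    have "strict_mono_on {1..n} (\<lambda>j. T (1, j))" "strict_mono_on {1..n} (\<lambda>j. T (2, j))"
      using f(1) g(1) by (auto simp: T_def strict_mono_on_def)
    moreover have "T \<in> extensional ({1..2} \<times> {1..n})"
      by (simp add: T_def)
    ultimately have "T \<in> RInc k n"
      using p by (simp add: RInc_iff rows AB del: One_nat_def)
    then show "\<exists>T\<in>RInc k n. p = (row n T 1, row n T 2)"
      using rows AB by blast
  qed
qed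

section \<open>Specialisation to arrays\<close>

lemma amaj_eq_pair_amaj: "amaj n T = pair_amaj (row n T 1, row n T 2)"
  by (simp add: amaj_def ascents_def pair_amaj_def)

lemma sum_RInc_eq_ballot_gf:
  assumes "k \<le> n"
  shows "(\<Sum>T\<in>RInc k n. q ^ amaj n T) = ballot_gf q (n - k) k (n - k)"
  unfolding ballot_gf_def amaj_eq_pair_amaj
  using sum.reindex_bij_betw[OF bij_betw_rows[OF assms], of "\<lambda>p. q ^ pair_amaj p"] by simp

theorem theorem1p4:
  fixes n k :: nat
  assumes "n > 0" and "k \<le> n"
  shows "(\<Sum>T\<in>RInc k n. indet ^ amaj n T) =
    indet ^ (k * (k - 1) div 2) / q_int indet (n - k + 1)
      * q_binomial indet (2 * n - k) k * q_binomial indet (2 * n - 2 * k) (n - k)"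
proof -
  define N where "N = n - k"
  have arith: "2 * n - k = N + k + N" "2 * n - 2 * k = N + N" "2 * n - k - k = N + N"
      "N + N - N = N"
    using assms(2) by (simp_all add: N_def)
  \<comment> \<open>For \<open>a = b = N\<close> the second factor of the closed form reduces to
    1.\<close>
  have cat: "q_int indet (Suc N) - indet * q_int indet N = 1"
    using q_int_add[of indet 1 N] by (simp add: q_int_Suc)
  have "q_int indet (Suc N) * ballot_gf indet N k N = super_multinomial indet N k N"
    using ballot_gf_closed_form(1)[OF indet_q_int_nonzero, of N N k] cat by simp
  then have "ballot_gf indet N k N = super_multinomial indet N k N / q_int indet (Suc N)"
    using indet_q_int_nonzero[of N] by (simp add: field_simps)
  \<comment> \<open>The two q-binomials share the factorial of \<open>N + N\<close>, which
    cancels.\<close>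
  moreover have "super_multinomial indet N k N =
      indet ^ (k choose 2) * q_binomial indet (2 * n - k) k * q_binomial indet (2 * n - 2 * k) N"
    unfolding super_multinomial_def q_binomial_def arith
    using q_fact_nonzero[OF indet_q_int_nonzero] by (simp add: field_simps)
  ultimately show ?thesis
    using sum_RInc_eq_ballot_gf[OF assms(2), of indet] by (simp add: N_def choose_two)
qed

end
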